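(* Let $f$ be the Gray Takagi function, $$f(x)=\sum_{n=0}^\infty\frac{r_n(x)}{2^n}\phi(2^n x),\qquad 0\le x\le 1,$$ where $r_n(x)=(-1)^{\lfloor 2^n x\rfloor}$ is the $n$th Rademacher function. Then $$\max_{y\in\mathbb{R}}\ \dim_H L_f(y)=\frac12 .$$
   Context: $\phi(x)=\operatorname{dist}(x,\mathbb{Z})$ is the distance from $x\in\mathbb{R}$ to the nearest integer. For $y\in\mathbb{R}$, $L_f(y)=\{x\in[0,1]: f(x)=y\}$. $\dim_H$ denotes Hausdorff dimension (with the convention $\dim_H\emptyset=0$). *)

theory Defs
  imports "HOL-Analysis.Analysis"
begin

definition dist_nearest_int :: "real \<Rightarrow> real" where
  "dist_nearest_int x = infdist x \<int>"

definition rademacher :: "nat \<Rightarrow> real \<Rightarrow> real" where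
  "rademacher n x = (-1) powi \<lfloor>2 ^ n * x\<rfloor>"

(* Total on the reals; the Gray Takagi function is its restriction to [0,1]. *)
definition gray_takagi :: "real \<Rightarrow> real" where
  "gray_takagi x = (\<Sum>n. rademacher n x / 2 ^ n * dist_nearest_int (2 ^ n * x))"

definition level_set :: "(real \<Rightarrow> real) \<Rightarrow> real \<Rightarrow> real set" where
  "level_set f y = {x \<in> {0..1}. f x = y}"

(* The cases implement diam(U)^s with 0^0 = 1 for nonempty U and the value 0 for U = {};
   powr alone would give 0 powr 0 = 0. *)
definition diam_power :: "real \<Rightarrow> 'a::metric_space set \<Rightarrow> ennreal" where
  "diam_power s U = (if U = {} then 0 else if s = 0 then 1 else ennreal (diameter U powr s))"

(* Boundedness is required because diameter is meaningless on unbounded sets. *)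
definition hausdorff_premeasure :: "real \<Rightarrow> real \<Rightarrow> 'a::metric_space set \<Rightarrow> ennreal" where
  "hausdorff_premeasure s \<delta> A =
     (INF U \<in> {U :: nat \<Rightarrow> 'a set. A \<subseteq> (\<Union>i. U i) \<and> (\<forall>i. bounded (U i) \<and> diameter (U i) \<le> \<delta>)}.
        \<Sum>i. diam_power s (U i))"

definition hausdorff_measure :: "real \<Rightarrow> 'a::metric_space set \<Rightarrow> ennreal" where
  "hausdorff_measure s A = (SUP \<delta> \<in> {0<..}. hausdorff_premeasure s \<delta> A)"

(* The infimum of the empty set is the top element, so the dimension may be infinite;
   the empty set gets dimension 0. *)
definition hausdorff_dim :: "'a::metric_space set \<Rightarrow> ennreal" where
  "hausdorff_dim A = (INF s \<in> {s. 0 \<le> s \<and> hausdorff_measure s A = 0}. ennreal s)"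

end

theory Submission
  imports Defs
begin

text \<open>
  Write \<open>f\<close> for the Gray Takagi function and \<open>h\<^sub>k(u) = f(u) + k u\<close> for integers \<open>k\<close>. The graph of \<open>f\<close> is
  self-affine: \<open>f(u/2) = (u + f(u))/2\<close> and \<open>f(1 - u/2) = (u - f(u))/2\<close> on the unit interval, so
  \<open>h\<^sub>k(u/2) = h\<^sub>k\<^sub>+\<^sub>1(u)/2\<close> and \<open>h\<^sub>k(1 - u/2) = k - h\<^sub>k\<^sub>-\<^sub>1(u)/2\<close>. Zooming into one half of the unit
  interval therefore replaces the problem \<open>h\<^sub>k = y\<close>, coded by the state \<open>(k, y)\<close>, by \<open>(k + 1, 2y)\<close> on the
  left half and by \<open>(k - 1, 2(k - y))\<close> on the right half. A state is dead when \<open>y\<close> lies outside the range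
  of \<open>h\<^sub>k\<close>, which is known up to a small error (\<open>tilted_bounds\<close>).

  Upper bound. The dyadic intervals of order \<open>m\<close> that a level set meets are counted by the live
  leaves of the binary tree of states (\<open>branches\<close>). For \<open>|k| \<ge> 2\<close> the two children of a state compete for
  almost disjoint ranges of \<open>y\<close>, so that the tree at most doubles every two generations. The only
  delicate states have \<open>k = 0\<close>. There a weight argument along single edges cannot work: at \<open>y = 2/5\<close> two
  loops of length two already give the full growth rate, and further children are produced on top.
  What saves the count is that the states \<open>(1, v)\<close> and \<open>(-1, -v)\<close> always occur together and are
  exactly the children of \<open>(0, v/2)\<close>; expanding three generations below \<open>(0, y)\<close> and regrouping in
  this way (\<open>load_zero_line\<close>) leaves twice the state \<open>(0, 2 - 4y)\<close> and once \<open>(0, -4y)\<close>, two generations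
  down, plus the harmless states with \<open>k = 3\<close> and \<open>k = -3\<close>. Induction then bounds the number of
  intervals of length \<open>4\<^sup>-\<^sup>m\<close> by \<open>32 \<cdot> 2\<^sup>m\<close> (\<open>load_bound\<close>), whence dimension at most one half for every
  level.

  Lower bound. The two loops through \<open>(1, 4/5)\<close> mean that the set \<open>h\<^sub>1 = 4/5\<close> is mapped into itself by
  \<open>v \<mapsto> 1/2 - v/4\<close> and \<open>v \<mapsto> 1 - v/4\<close>, two similarities of ratio one quarter with disjoint images. It
  contains their Cantor set, of dimension one half, and \<open>u \<mapsto> u/2\<close> carries it into the level set of \<open>f\<close> at
  \<open>2/5\<close>. The coding of the Cantor set by binary digits has an inverse that is Hoelder continuous with
  exponent one half, so Lebesgue measure on the unit interval bounds the Hausdorff measure from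
  below (\<open>hausdorff_premeasure_half_ge\<close>).
\<close>

section \<open>The functional equations\<close>

lemma dist_nearest_int_eqI:
  assumes "0 \<le> x" "x \<le> 1/2"
  shows "dist_nearest_int x = x"
proof (rule antisym)
  show "dist_nearest_int x \<le> x"
    unfolding dist_nearest_int_def using infdist_le[of 0 \<int> x] assms by simp
  have "x \<le> dist x z" if "z \<in> \<int>" for z
  proof -
    obtain i where z: "z = of_int i" using \<open>z \<in> \<int>\<close> by (rule Ints_cases)
    have "i \<le> 0 \<or> 1 \<le> i" by linarith
    then have "z \<le> 0 \<or> 1 \<le> z" unfolding z by auto
    then show ?thesis using assms by (auto simp: dist_real_def)
  qed
  then show "x \<le> dist_nearest_int x"
    unfolding dist_nearest_int_def infdist_def by (auto intro!: cINF_greatest)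
qed

lemma dist_nearest_int_minus: "dist_nearest_int (of_int i - x) = dist_nearest_int x"
proof -
  have "(\<lambda>z. dist (of_int i - x) z) ` \<int> = (\<lambda>z. dist x z) ` \<int>"
  proof (intro equalityI subsetI)
    fix d assume "d \<in> (\<lambda>z. dist (of_int i - x) z) ` \<int>"
    then obtain z where "z \<in> \<int>" "d = dist (of_int i - x) z" by blast
    then show "d \<in> (\<lambda>z. dist x z) ` \<int>"
      by (intro image_eqI[of _ _ "of_int i - z"]) (auto simp: dist_real_def)
  next
    fix d assume "d \<in> (\<lambda>z. dist x z) ` \<int>"
    then obtain z where "z \<in> \<int>" "d = dist x z" by blast
    then show "d \<in> (\<lambda>z. dist (of_int i - x) z) ` \<int>"
      by (intro image_eqI[of _ _ "of_int i - z"]) (auto simp: dist_real_def)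
  qed
  then show ?thesis by (simp add: dist_nearest_int_def infdist_def)
qed

lemma dist_nearest_int_Ints: "x \<in> \<int> \<Longrightarrow> dist_nearest_int x = 0"
  by (simp add: dist_nearest_int_def)

lemma dist_nearest_int_bounds: "0 \<le> dist_nearest_int x" "dist_nearest_int x \<le> 1"
proof -
  show "0 \<le> dist_nearest_int x" by (simp add: dist_nearest_int_def infdist_nonneg)
  have "dist_nearest_int x \<le> dist x (of_int \<lfloor>x\<rfloor>)"
    unfolding dist_nearest_int_def by (rule infdist_le) simp
  then show "dist_nearest_int x \<le> 1" by (simp add: dist_real_def) linarith
qed

text \<open>The summands of \<open>f\<close> are rescaled copies of this one function. It equals the tent on the
  unit interval, its negative on the next interval, and has period two.\<close>

definition signed_wave :: "real \<Rightarrow> real" where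
  "signed_wave x = (-1) powi \<lfloor>x\<rfloor> * dist_nearest_int x"

lemma abs_signed_wave_le: "\<bar>signed_wave x\<bar> \<le> 1"
  using dist_nearest_int_bounds[of x]
  by (simp add: signed_wave_def abs_mult power_int_abs[symmetric])

lemma signed_wave_low: "0 \<le> x \<Longrightarrow> x \<le> 1/2 \<Longrightarrow> signed_wave x = x"
  unfolding signed_wave_def by (subst floor_unique[of 0]) (auto simp: dist_nearest_int_eqI)

lemma signed_wave_high: 
  assumes "0 \<le> x" "x \<le> 1/2"
  shows "signed_wave (1 - x) = x"
proof (cases "x = 0")
  case True then show ?thesis by (simp add: signed_wave_def dist_nearest_int_Ints)
next
  case False
  then have "\<lfloor>1 - x\<rfloor> = 0" using assms by (intro floor_unique) auto
  then show ?thesis using assms dist_nearest_int_minus[of 1 x]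
    by (simp add: signed_wave_def dist_nearest_int_eqI)
qed

text \<open>The sign alone is not odd at the integers, but there the distance vanishes.\<close>

lemma signed_wave_reflect:
  assumes "even i"
  shows "signed_wave (of_int i - x) = - signed_wave x"
proof (cases "x \<in> \<int>")
  case True
  then show ?thesis by (simp add: signed_wave_def dist_nearest_int_Ints)
next
  case False
  then have "of_int \<lfloor>x\<rfloor> \<noteq> x" by (metis Ints_of_int)
  then have "\<lfloor>of_int i - x\<rfloor> = i - \<lfloor>x\<rfloor> - 1" 
    by (intro floor_unique) linarith+
  then show ?thesis using assms
    by (simp add: signed_wave_def dist_nearest_int_minus power_int_minus_one_diff_commute power_int_minus_left)
qed

lemma gray_takagi_waves: "gray_takagi x = (\<Sum>n. signed_wave (2 ^ n * x) / 2 ^ n)"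
  by (simp add: gray_takagi_def signed_wave_def rademacher_def)

lemma norm_wave_le: "norm (signed_wave (2 ^ n * x) / 2 ^ n) \<le> (1/2) ^ n"
proof -
  have "\<bar>signed_wave (2 ^ n * x)\<bar> / 2 ^ n \<le> 1 / 2 ^ n"
    by (intro divide_right_mono abs_signed_wave_le) simp
  then show ?thesis by (simp add: power_one_over)
qed

lemma summable_waves: "summable (\<lambda>n. signed_wave (2 ^ n * x) / 2 ^ n)"
proof (rule summable_comparison_test'[of "\<lambda>n. (1/2) ^ n" 0])
  show "summable (\<lambda>n. (1/2 :: real) ^ n)" by simp
qed (rule norm_wave_le)

lemma abs_gray_takagi_le: "\<bar>gray_takagi x\<bar> \<le> 2"
proof -
  have "norm (\<Sum>n. signed_wave (2 ^ n * x) / 2 ^ n) \<le> (\<Sum>n. (1/2) ^ n)"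
    by (rule norm_suminf_le[OF norm_wave_le]) auto
  then show ?thesis by (simp add: gray_takagi_waves suminf_geometric)
qed

lemma gray_takagi_split:
  "gray_takagi x = signed_wave x + (\<Sum>n. signed_wave (2 ^ n * (2 * x)) / 2 ^ n) / 2"
proof -
  have "gray_takagi x = signed_wave x + (\<Sum>n. signed_wave (2 ^ Suc n * x) / 2 ^ Suc n)"
    unfolding gray_takagi_waves using suminf_split_head[OF summable_waves[of x]] by simp
  also have "(\<lambda>n. signed_wave (2 ^ Suc n * x) / 2 ^ Suc n)
      = (\<lambda>n. signed_wave (2 ^ n * (2 * x)) / 2 ^ n / 2)"
    by (simp add: mult_ac)
  finally show ?thesis by (simp only: suminf_divide[OF summable_waves])
qed

lemma gray_takagi_left:
  assumes "0 \<le> u" "u \<le> 1"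
  shows "gray_takagi (u / 2) = (u + gray_takagi u) / 2"
  using gray_takagi_split[of "u / 2"] signed_wave_low[of "u / 2"] assms
  by (simp add: gray_takagi_waves[of u] add_divide_distrib)

text \<open>The right half of the graph is a reflected copy of the whole: the argument of each later summand
  is a reflection of its argument at \<open>u\<close> about an integer, and this flips its sign.\<close>

lemma gray_takagi_right:
  assumes "0 \<le> u" "u \<le> 1"
  shows "gray_takagi (1 - u / 2) = (u - gray_takagi u) / 2"
proof -
  have *: "signed_wave (2 ^ n * (2 * (1 - u / 2))) = - signed_wave (2 ^ n * u)" for n
    using signed_wave_reflect[of "2 * 2 ^ n" "2 ^ n * u"] by (simp add: algebra_simps)
  show ?thesis
    using gray_takagi_split[of "1 - u / 2"] signed_wave_high[of "u / 2"] assms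
    unfolding * by (simp add: gray_takagi_waves[of u] suminf_minus summable_waves diff_divide_distrib)
qed

section \<open>Lines meeting the graph\<close>

definition tilted :: "int \<Rightarrow> real \<Rightarrow> real" where
  "tilted k u = gray_takagi u + of_int k * u"

lemma tilted_left:
  "0 \<le> u \<Longrightarrow> u \<le> 1 \<Longrightarrow> tilted k (u / 2) = tilted (k + 1) u / 2"
  by (simp add: tilted_def gray_takagi_left field_simps)

lemma tilted_right:
  "0 \<le> u \<Longrightarrow> u \<le> 1 \<Longrightarrow> tilted k (1 - u / 2) = of_int k - tilted (k - 1) u / 2"
  unfolding tilted_def gray_takagi_right[of u] by (simp add: field_simps)

text \<open>The interval from \<open>lo k\<close> to \<open>hi k\<close> contains the values of \<open>h\<^sub>k\<close>. The ends for
  \<open>k \<ge> -1\<close> solve the self-affine equations exactly; for \<open>k \<le> -2\<close> they are rounded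
  outwards, since the exact ends involve \<open>2\<^sup>k\<close>.\<close>

definition lo :: "int \<Rightarrow> real" where
  "lo k = (if 1 \<le> k then 0 else if k = 0 then - 2 / 15 else of_int k - 1 / 15)"

definition hi :: "int \<Rightarrow> real" where
  "hi k = (if 2 \<le> k then of_int k else if k = 1 then 16 / 15 else if k = 0 then 8 / 15
           else if k = - 1 then 4 / 15 else 2 / 15)"

text \<open>These inclusions say that the family of intervals is mapped into itself by the self-affine
  equations. As both equations contract by one half, the values of \<open>h\<^sub>k\<close> cannot leave the intervals, and
  a state with a live child is itself live.\<close>

lemma lo_hi_invariant:
  "lo k \<le> lo (k + 1) / 2" "hi (k + 1) / 2 \<le> hi k"
  "lo k \<le> of_int k - hi (k - 1) / 2" "of_int k - lo (k - 1) / 2 \<le> hi k"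
proof -
  have "k \<le> - 3 \<or> k = - 2 \<or> k = - 1 \<or> k = 0 \<or> k = 1 \<or> k = 2 \<or> 3 \<le> k" by linarith
  then have "lo k \<le> lo (k + 1) / 2 \<and> hi (k + 1) / 2 \<le> hi k \<and>
      lo k \<le> of_int k - hi (k - 1) / 2 \<and> of_int k - lo (k - 1) / 2 \<le> hi k"
  proof (elim disjE)
    assume "k \<le> - 3"
    then have "real_of_int k \<le> - 3" by simp
    then show ?thesis using \<open>k \<le> - 3\<close> by (simp add: lo_def hi_def field_simps)
  qed (simp_all add: lo_def hi_def)
  then show "lo k \<le> lo (k + 1) / 2" "hi (k + 1) / 2 \<le> hi k"
    "lo k \<le> of_int k - hi (k - 1) / 2" "of_int k - lo (k - 1) / 2 \<le> hi k" by blast+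
qed

lemma le_by_halving:
  fixes x y c :: real
  assumes "\<And>n. x \<le> y + c * (1/2) ^ n"
  shows "x \<le> y"
proof (rule LIMSEQ_le_const)
  have "(\<lambda>n. y + c * (1/2) ^ n) \<longlonglongrightarrow> y + c * 0"
    by (intro tendsto_intros LIMSEQ_power_zero) auto
  then show "(\<lambda>n. y + c * (1/2) ^ n) \<longlonglongrightarrow> y" by simp
qed (use assms in blast)

lemma half_cases:
  fixes u :: real
  assumes "0 \<le> u" "u \<le> 1"
  obtains v where "0 \<le> v" "v \<le> 1" "u = v / 2" | v where "0 \<le> v" "v < 1" "u = 1 - v / 2"
proof (cases "u \<le> 1/2")
  case True
  then show ?thesis using that(1)[of "2 * u"] assms by simp
next
  case False
  then show ?thesis using that(2)[of "2 - 2 * u"] assms by (simp add: diff_divide_distrib)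
qed

text \<open>Each use of a functional equation halves the distance by which \<open>h\<^sub>k\<close> could leave its interval,
  and a crude bound uniform in \<open>k\<close> starts the induction.\<close>

lemma tilted_bounds_approx:
  assumes "0 \<le> u" "u \<le> 1"
  shows "lo k - 3 * (1/2) ^ n \<le> tilted k u \<and> tilted k u \<le> hi k + 3 * (1/2) ^ n"
  using assms
proof (induction n arbitrary: k u)
  case 0
  have "lo k \<le> of_int k * u \<and> of_int k * u \<le> hi k"
  proof (cases "0 \<le> k")
    case True
    then have "0 \<le> of_int k * u" "of_int k * u \<le> of_int k * 1"
      using 0 by (intro mult_nonneg_nonneg mult_left_mono; simp)+
    moreover have "lo k \<le> 0" "of_int k \<le> hi k" using True by (auto simp: lo_def hi_def)
    ultimately show ?thesis by linarith
  next
    case False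
    then have "of_int k * u \<le> 0" "of_int k * 1 \<le> of_int k * u"
      using 0 by (intro mult_nonpos_nonneg mult_left_mono_neg; simp)+
    moreover have "lo k \<le> of_int k" "0 \<le> hi k" using False by (auto simp: lo_def hi_def)
    ultimately show ?thesis by linarith
  qed
  then show ?case using abs_gray_takagi_le[of u] unfolding tilted_def abs_le_iff by simp
next
  case (Suc n)
  from Suc.prems show ?case
  proof (cases rule: half_cases)
    case (1 v)
    have "tilted k u = tilted (k + 1) v / 2" unfolding 1(3) by (rule tilted_left[OF 1(1,2)])
    then show ?thesis using Suc.IH[OF 1(1,2), of "k + 1"] lo_hi_invariant(1,2)[of k] by simp
  next
    case (2 v)
    have v: "0 \<le> v" "v \<le> 1" using 2 by simp_all
    have "tilted k u = of_int k - tilted (k - 1) v / 2" unfolding 2(3) by (rule tilted_right[OF v])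
    then show ?thesis using Suc.IH[OF v, of "k - 1"] lo_hi_invariant(3,4)[of k] by simp
  qed
qed

lemma tilted_bounds:
  assumes "0 \<le> u" "u \<le> 1"
  shows "lo k \<le> tilted k u" "tilted k u \<le> hi k"
proof -
  have *: "lo k \<le> tilted k u + 3 * (1/2) ^ n" "tilted k u \<le> hi k + 3 * (1/2) ^ n" for n
    using tilted_bounds_approx[OF assms, of k n] by linarith+
  show "lo k \<le> tilted k u" by (rule le_by_halving[OF *(1)])
  show "tilted k u \<le> hi k" by (rule le_by_halving[OF *(2)])
qed

text \<open>Positivity spreads from the right half of the interval to the left by doubling \<open>u\<close>.\<close>

lemma tilted_pos:
  assumes "1 \<le> k" "0 < u" "u \<le> 1"
  shows "0 < tilted k u"
proof -
  have main: "0 < tilted k u" if "(1/2) ^ n \<le> u" "1 \<le> k" "u \<le> 1" for n k and u :: real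
    using that
  proof (induction n arbitrary: k u)
    case 0
    then have "u = 1 - 0 / 2" by simp
    then show ?case using 0 tilted_right[of 0 k] by (simp add: tilted_def) 
       (use gray_takagi_right[of 0] gray_takagi_left[of 0] in simp)
  next
    case (Suc n)
    have "0 \<le> u" using Suc.prems(1) by (rule order_trans[rotated]) simp
    then show ?case using Suc.prems(3)
    proof (cases rule: half_cases)
      case (1 v)
      have "tilted k u = tilted (k + 1) v / 2" unfolding 1(3) by (rule tilted_left[OF 1(1,2)])
      moreover have "(1/2) ^ n \<le> v" using Suc.prems(1) 1(3) by simp
      ultimately show ?thesis using Suc.IH[of v "k + 1"] Suc.prems(2) 1(2) by simp
    next
      case (2 v)
      have v: "0 \<le> v" "v \<le> 1" using 2 by simp_all
      have "tilted k u = of_int k - tilted (k - 1) v / 2" unfolding 2(3) by (rule tilted_right[OF v])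
      then show ?thesis using tilted_bounds(2)[OF v, of "k - 1"] Suc.prems(2)
        by (auto simp: hi_def split: if_splits)
    qed
  qed
  obtain n where "(1/2) ^ n < u" using real_arch_pow_inv[of u "1/2"] assms by auto
  then show ?thesis using main[of n u k] assms by simp
qed

lemma tilted_less:
  assumes "2 \<le> k" "0 \<le> u" "u < 1"
  shows "tilted k u < of_int k"
  using assms(2) less_imp_le[OF assms(3)]
proof (cases rule: half_cases)
  case (1 v)
  have "tilted k u = tilted (k + 1) v / 2" unfolding 1(3) by (rule tilted_left[OF 1(1,2)])
  then show ?thesis using tilted_bounds(2)[OF 1(1,2), of "k + 1"] assms(1) by (simp add: hi_def)
next
  case (2 v)
  have "tilted k u = of_int k - tilted (k - 1) v / 2" unfolding 2(3) by (rule tilted_right) (use 2 in simp_all)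
  moreover have "0 < v" using 2(3) assms(3) by simp
  ultimately show ?thesis using tilted_pos[of "k - 1" v] 2(2) assms(1) by simp
qed

text \<open>Excluding the end points for positive \<open>k\<close> matters: at \<open>y = (k + 1)/2\<close> with \<open>k \<ge> 3\<close> the closed ranges would
  let both children survive, although only the common end point of the two halves is responsible.\<close>

definition live :: "int \<Rightarrow> real \<Rightarrow> bool" where
  "live k y \<longleftrightarrow> lo k \<le> y \<and> y \<le> hi k \<and> (1 \<le> k \<longrightarrow> 0 < y) \<and> (2 \<le> k \<longrightarrow> y < of_int k)"

lemma live_tilted: "0 < u \<Longrightarrow> u < 1 \<Longrightarrow> live k (tilted k u)"
  by (simp add: live_def tilted_bounds tilted_pos tilted_less)

lemma live_child:
  "live (k + 1) (2 * y) \<Longrightarrow> live k y"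
  "live (k - 1) (2 * (of_int k - y)) \<Longrightarrow> live k y"
proof -
  have "k \<le> - 2 \<or> k = - 1 \<or> k = 0 \<or> k = 1 \<or> k = 2 \<or> 3 \<le> k" by linarith
  then have "(live (k + 1) (2 * y) \<longrightarrow> live k y) \<and> (live (k - 1) (2 * (of_int k - y)) \<longrightarrow> live k y)"
    by (elim disjE) (auto simp: live_def lo_def hi_def)
  then show "live (k + 1) (2 * y) \<Longrightarrow> live k y"
    "live (k - 1) (2 * (of_int k - y)) \<Longrightarrow> live k y" by blast+
qed

section \<open>Counting dyadic intervals that a line can meet\<close>

fun branches :: "nat \<Rightarrow> int \<Rightarrow> real \<Rightarrow> nat" where
  "branches 0 k y = (if live k y then 1 else 0)"
| "branches (Suc m) k y = branches m (k + 1) (2 * y) + branches m (k - 1) (2 * (of_int k - y))"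

lemma branches_dead: "\<not> live k y \<Longrightarrow> branches m k y = 0"
proof (induction m arbitrary: k y)
  case (Suc m)
  have "\<not> live (k + 1) (2 * y)" "\<not> live (k - 1) (2 * (of_int k - y))"
    using live_child Suc.prems by blast+
  then show ?case using Suc.IH by simp
qed simp

lemma branches_le_power: "branches m k y \<le> 2 ^ m"
proof (induction m arbitrary: k y)
  case (Suc m)
  show ?case using Suc[of "k + 1" "2 * y"] Suc[of "k - 1" "2 * (of_int k - y)"] by simp
qed simp

text \<open>Dyadic points are set aside so that zooming in never reaches an end point of the unit
  interval, where \<open>live\<close> may fail; they form a countable set.\<close>

definition nondyadic :: "real set" where
  "nondyadic = {u \<in> {0<..<1}. \<forall>n. 2 ^ n * u \<notin> \<int>}"

lemma nondyadic_cases: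
  assumes "u \<in> nondyadic"
  obtains v where "v \<in> nondyadic" "u = v / 2" | v where "v \<in> nondyadic" "u = 1 - v / 2"
proof -
  have u: "0 < u" "u < 1" and nd: "2 ^ n * u \<notin> \<int>" for n
    using assms by (auto simp: nondyadic_def)
  have "u \<noteq> 1/2"
  proof
    assume "u = 1/2"
    then have "2 ^ 1 * u = 1" by simp
    then show False using nd[of 1] by simp
  qed
  then consider "u < 1/2" | "1/2 < u" by linarith
  then show ?thesis
  proof cases
    case 1
    have "2 * u \<in> nondyadic"
      using nd[of "Suc _"] u 1 by (auto simp: nondyadic_def mult_ac)
    then show ?thesis using that(1)[of "2 * u"] by simp
  next
    case 2
    have "2 ^ n * (2 - 2 * u) \<notin> \<int>" for n
    proof
      assume "2 ^ n * (2 - 2 * u) \<in> \<int>"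
      then have "2 ^ Suc n - 2 ^ n * (2 - 2 * u) \<in> \<int>" by (intro Ints_diff Ints_power) auto
      then show False using nd[of "Suc n"] by (simp add: algebra_simps)
    qed
    then have "2 - 2 * u \<in> nondyadic" using u 2 by (auto simp: nondyadic_def)
    then show ?thesis using that(2)[of "2 - 2 * u"] by (simp add: diff_divide_distrib)
  qed
qed

text \<open>Following a solution of \<open>h\<^sub>k = y\<close> through \<open>m\<close> zooms leads to a live leaf, and the leaf
  determines the dyadic interval of order \<open>m\<close> in which the solution lies.\<close>

lemma branches_cover:
  "\<exists>cs. length cs = branches m k y \<and>
     {u \<in> nondyadic. tilted k u = y} \<subseteq> (\<Union>c \<in> set cs. {c .. c + 1 / 2 ^ m})"
proof (induction m arbitrary: k y)
  case 0
  show ?case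
  proof (cases "live k y")
    case True
    then show ?thesis by (intro exI[of _ "[0]"]) (auto simp: nondyadic_def)
  next
    case False
    then show ?thesis using live_tilted by (intro exI[of _ "[]"]) (auto simp: nondyadic_def)
  qed
next
  case (Suc m)
  obtain cs where cs: "length cs = branches m (k + 1) (2 * y)"
    "{u \<in> nondyadic. tilted (k + 1) u = 2 * y} \<subseteq> (\<Union>c \<in> set cs. {c .. c + 1 / 2 ^ m})"
    using Suc by blast
  obtain ds where ds: "length ds = branches m (k - 1) (2 * (of_int k - y))"
    "{u \<in> nondyadic. tilted (k - 1) u = 2 * (of_int k - y)}
       \<subseteq> (\<Union>c \<in> set ds. {c .. c + 1 / 2 ^ m})"
    using Suc by blast
  define es where
    "es = map (\<lambda>c. c / 2) cs @ map (\<lambda>d. 1 - d / 2 - 1 / 2 ^ Suc m) ds"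
  have "u \<in> (\<Union>c \<in> set es. {c .. c + 1 / 2 ^ Suc m})" if "u \<in> nondyadic" "tilted k u = y" for u
    using that(1)
  proof (cases rule: nondyadic_cases)
    case (1 v)
    then have "tilted (k + 1) v = 2 * y"
      using that tilted_left[of v k] by (auto simp: nondyadic_def)
    then obtain c where "c \<in> set cs" "v \<in> {c .. c + 1 / 2 ^ m}" using cs 1 by blast
    then show ?thesis using 1 by (intro UN_I[of "c / 2"]) (auto simp: es_def)
  next
    case (2 v)
    then have "tilted (k - 1) v = 2 * (of_int k - y)"
      using that tilted_right[of v k] by (auto simp: nondyadic_def)
    then obtain d where "d \<in> set ds" "v \<in> {d .. d + 1 / 2 ^ m}" using ds 2 by blast
    then have "1 - d / 2 - 1 / 2 ^ Suc m \<in> set es"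
      and "u \<in> {1 - d / 2 - 1 / 2 ^ Suc m .. 1 - d / 2 - 1 / 2 ^ Suc m + 1 / 2 ^ Suc m}"
      using 2(2) by (auto simp: es_def)
    then show ?thesis by blast
  qed
  then have "{u \<in> nondyadic. tilted k u = y} \<subseteq> (\<Union>c \<in> set es. {c .. c + 1 / 2 ^ Suc m})"
    by blast
  moreover have "length es = branches (Suc m) k y" using cs ds by (simp add: es_def)
  ultimately show ?case by blast
qed

section \<open>The number of branches grows like the square root\<close>

text \<open>The number of branches relative to the growth to be proved. A state reached from \<open>k = 0\<close> has
  \<open>m + k\<close> of fixed parity, and rounding \<open>m/2\<close> according to the parity of \<open>k\<close> keeps all factors
  rational: a step from an even state preserves the normalisation, a step from an odd state halves it.
  The factor 32 makes the bounds trivial for \<open>m < 5\<close>.\<close>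

definition load :: "nat \<Rightarrow> int \<Rightarrow> real \<Rightarrow> real" where
  "load m k y = real (branches m k y) / (32 * 2 ^ ((if even k then m else Suc m) div 2))"

definition weight :: "int \<Rightarrow> real" where
  "weight k = (if \<bar>k\<bar> \<le> 2 then 1 else 1 / 2)"

lemma load_dead: "\<not> live k y \<Longrightarrow> load m k y = 0"
  by (simp add: load_def branches_dead)

lemma load_even:
  "even k \<Longrightarrow> load (Suc m) k y = load m (k + 1) (2 * y) + load m (k - 1) (2 * (of_int k - y))"
  by (simp add: load_def add_divide_distrib)

lemma load_odd:
  "odd k \<Longrightarrow> load (Suc m) k y = (load m (k + 1) (2 * y) + load m (k - 1) (2 * (of_int k - y))) / 2"
  by (simp add: load_def add_divide_distrib)

text \<open>The key identity. The contributions \<open>(1, 4 - 8y)\<close> and \<open>(-1, 8y - 4)\<close>, which arise in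
  different branches, are together equal to the load of \<open>(0, 2 - 4y)\<close> one generation earlier.\<close>

lemma load_zero_line:
  "load (Suc (Suc (Suc m))) 0 y = load (Suc m) 0 (2 - 4 * y) + load (Suc m) 0 (- 4 * y) / 2
     + (load m 3 (8 * y) + load m (- 3) (- 8 * y)) / 2"
proof -
  have "load (Suc (Suc (Suc m))) 0 y = load (Suc (Suc m)) 1 (2 * y) + load (Suc (Suc m)) (- 1) (- 2 * y)"
    by (subst load_even) auto
  moreover have "load (Suc (Suc m)) 1 (2 * y) = (load (Suc m) 2 (4 * y) + load (Suc m) 0 (2 - 4 * y)) / 2"
    by (subst load_odd) (auto simp: algebra_simps)
  moreover have "load (Suc (Suc m)) (- 1) (- 2 * y) = (load (Suc m) 0 (- 4 * y) + load (Suc m) (- 2) (4 * y - 2)) / 2"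
    by (subst load_odd) (auto simp: algebra_simps)
  moreover have "load (Suc m) 2 (4 * y) = load m 3 (8 * y) + load m 1 (4 - 8 * y)"
    by (subst load_even) (auto simp: algebra_simps)
  moreover have "load (Suc m) (- 2) (4 * y - 2) = load m (- 1) (8 * y - 4) + load m (- 3) (- 8 * y)"
    by (subst load_even) (auto simp: algebra_simps)
  moreover have "load (Suc m) 0 (2 - 4 * y) = load m 1 (4 - 8 * y) + load m (- 1) (8 * y - 4)"
    by (subst load_even) (auto simp: algebra_simps)
  ultimately show ?thesis by (simp add: field_simps)
qed

text \<open>Away from \<open>k = 0\<close> the bounds reproduce themselves. For \<open>k \<ge> 3\<close> the live ranges of the two
  children are disjoint. For \<open>k = 2\<close> and \<open>k \<le> -2\<close> they overlap only in a short interval around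
  \<open>(k + 1)/2\<close> (up to rounding); there a child sits at the end of its own range and has only one
  live child in turn, which saves a factor of two. For \<open>k = 1\<close> and \<open>k = -1\<close> the bound is immediate,
  because the load of an odd state is the mean of the loads of its children.\<close>

lemma load_step_nonzero:
  assumes IH0: "\<And>k y. load m k y \<le> weight k"
    and IH1: "\<And>k y. load (Suc m) k y \<le> weight k"
    and "k \<noteq> 0"
  shows "load (Suc (Suc m)) k y \<le> weight k"
proof -
  define A where "A = load (Suc m) (k + 1) (2 * y)"
  define B where "B = load (Suc m) (k - 1) (2 * (of_int k - y))"
  have even: "even k \<Longrightarrow> load (Suc (Suc m)) k y = A + B"
    and odd: "odd k \<Longrightarrow> load (Suc (Suc m)) k y = (A + B) / 2"
    by (simp_all add: A_def B_def load_even[of k] load_odd[of k])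
  have A: "A \<le> weight (k + 1)" and B: "B \<le> weight (k - 1)"
    and A0: "\<not> live (k + 1) (2 * y) \<Longrightarrow> A = 0"
    and B0: "\<not> live (k - 1) (2 * (of_int k - y)) \<Longrightarrow> B = 0"
    by (simp_all add: A_def B_def IH1 load_dead)
  consider "k = 1 \<or> k = - 1" | "k = 2" | "k = - 2" | "3 \<le> k" | "k = - 3" | "k \<le> - 4"
    using \<open>k \<noteq> 0\<close> by linarith
  then show ?thesis
  proof cases
    case 1
    then show ?thesis using odd A B by (auto simp: weight_def)
  next
    case k: 2
    consider "y < 22 / 15" | "3 / 2 \<le> y" | "22 / 15 \<le> y" "y < 3 / 2" by linarith
    then show ?thesis
    proof cases
      case 1
      then show ?thesis using k even A B0 by (auto simp: weight_def live_def hi_def)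
    next
      case 2
      then show ?thesis using k even B A0 by (auto simp: weight_def live_def hi_def)
    next
      case 3
      have "B = (load m 2 (2 * (2 * (2 - y))) + load m 0 (2 * (1 - 2 * (2 - y)))) / 2"
        by (simp add: B_def k load_odd)
      also have "load m 2 (2 * (2 * (2 - y))) = 0"
        using 3 by (intro load_dead) (auto simp: live_def)
      finally have "B \<le> 1 / 2" using IH0[of 0] by (simp add: weight_def)
      then show ?thesis using k even A by (simp add: weight_def)
    qed
  next
    case k: 3
    consider "y < - 8 / 15" | "- 7 / 15 < y" | "- 8 / 15 \<le> y" "y \<le> - 7 / 15" by linarith
    then show ?thesis
    proof cases
      case 1
      then show ?thesis using k even B A0 by (auto simp: weight_def live_def lo_def)
    next
      case 2
      then show ?thesis using k even A B0 by (auto simp: weight_def live_def lo_def)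
    next
      case 3
      have "A = (load m 0 (2 * (2 * y)) + load m (- 2) (2 * (- 1 - 2 * y))) / 2"
        by (simp add: A_def k load_odd)
      also have "load m 0 (2 * (2 * y)) = 0"
        using 3 by (intro load_dead) (auto simp: live_def lo_def)
      finally have "A \<le> 1 / 2" using IH0[of "- 2"] by (simp add: weight_def)
      then show ?thesis using k even B by (simp add: weight_def)
    qed
  next
    case k: 4
    have "A = 0 \<or> B = 0"
    proof (cases "y \<le> (of_int k + 1) / 2")
      case True
      then show ?thesis using k B0 by (auto simp: live_def)
    next
      case False
      then show ?thesis using k A0 by (auto simp: live_def)
    qed
    moreover have "odd k \<Longrightarrow> A \<le> 1 \<and> B \<le> 1" "even k \<Longrightarrow> A \<le> 1 / 2 \<and> B \<le> 1 / 2"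
      using A B k by (auto simp: weight_def split: if_splits)
    ultimately show ?thesis using even odd k 
      by (cases "even k") (auto simp: weight_def)
  next
    case k: 5
    consider "y < - 16 / 15 \<or> - 14 / 15 < y" | "- 16 / 15 \<le> y" "y \<le> - 14 / 15" by linarith
    then show ?thesis
    proof cases
      case 1
      then have "A = 0 \<or> B = 0" using k A0 B0 by (auto simp: live_def lo_def)
      then show ?thesis using k odd A B by (auto simp: weight_def)
    next
      case 2
      have "A = load m (- 1) (2 * (2 * y)) + load m (- 3) (2 * (- 2 - 2 * y))"
        by (simp add: A_def k load_even)
      also have "load m (- 1) (2 * (2 * y)) = 0"
        using 2 by (intro load_dead) (auto simp: live_def lo_def)
      finally have "A \<le> 1 / 2" using IH0[of "- 3"] by (simp add: weight_def)
      then show ?thesis using k odd B by (simp add: weight_def)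
    qed
  next
    case k: 6
    then have kr: "real_of_int k \<le> - 4" by simp
    have AB: "A \<le> 1 / 2" "B \<le> 1 / 2" using A B k by (auto simp: weight_def)
    show ?thesis
    proof (cases "even k")
      case False
      then show ?thesis using odd AB k by (simp add: weight_def)
    next
      case True
      consider "live (k + 1) (2 * y)" "live (k - 1) (2 * (of_int k - y))" | "A = 0" | "B = 0"
        using A0 B0 by blast
      then show ?thesis
      proof cases
        case 1
        then have y: "of_int k + 1 - 1/15 \<le> 2 * y" "of_int k - 1 - 1/15 \<le> 2 * (of_int k - y)"
          using k by (auto simp: live_def lo_def)
        have "A = (load m (k + 2) (2 * (2 * y)) + load m k (2 * (of_int (k + 1) - 2 * y))) / 2"
          using True by (simp add: A_def load_odd add.commute)
        also have "load m (k + 2) (2 * (2 * y)) = 0"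
          using y kr k by (intro load_dead) (auto simp: live_def lo_def)
        finally have "A \<le> 1 / 4"
          using IH0[of k "2 * (of_int (k + 1) - 2 * y)"] k by (simp add: weight_def)
        moreover have "B = (load m k (2 * (2 * (of_int k - y)))
            + load m (k - 2) (2 * (of_int (k - 1) - 2 * (of_int k - y)))) / 2"
          using True by (simp add: B_def load_odd)
        then have "B = load m (k - 2) (2 * (of_int (k - 1) - 2 * (of_int k - y))) / 2"
          using load_dead[of k "2 * (2 * (of_int k - y))" m] y kr k
          by (auto simp: live_def lo_def)
        then have "B \<le> 1 / 4" using IH0[of "k - 2" "2 * (of_int (k - 1) - 2 * (of_int k - y))"] k
          by (simp add: weight_def)
        ultimately show ?thesis using even True k by (simp add: weight_def)
      qed (use even True AB k in \<open>auto simp: weight_def\<close>)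
    qed
  qed
qed

text \<open>Small and large levels at \<open>k = 3\<close>, and low levels at \<open>k = -3\<close>, have only one live child,
  whose load is at most 1/2; halving gives 1/4 in place of the general weight 1/2. These gains pay for the overlaps of
  the ranges in \<open>load_zero_line\<close>.\<close>

lemma load_three_le:
  assumes "\<And>k y. load m k y \<le> weight k" "y < 2"
  shows "load (Suc m) 3 y \<le> 1 / 4"
proof -
  have "load m 2 (2 * (3 - y)) = 0"
    using assms(2) by (intro load_dead) (auto simp: live_def)
  then show ?thesis using assms(1)[of 4 "2 * y"] by (simp add: load_odd weight_def)
qed

lemma load_three_top:
  assumes "\<And>k y. load m k y \<le> weight k" "44 / 15 \<le> y"
  shows "load (Suc (Suc m)) 3 y \<le> 1 / 4"
proof -
  have "load m 1 (2 * (2 - 2 * (3 - y))) = 0"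
    using assms(2) by (intro load_dead) (auto simp: live_def hi_def)
  then have "load (Suc m) 2 (2 * (3 - y)) \<le> 1 / 2"
    using assms(1)[of 3] by (simp add: load_even weight_def)
  moreover have "load (Suc m) 4 (2 * y) = 0"
    using assms(2) by (intro load_dead) (auto simp: live_def)
  ultimately show ?thesis by (simp add: load_odd)
qed

lemma load_minus_three_bottom:
  assumes "\<And>k y. load m k y \<le> weight k" "y \<le> - 44 / 15"
  shows "load (Suc m) (- 3) y \<le> 1 / 4"
proof -
  have "load m (- 2) (2 * y) = 0"
    using assms(2) by (intro load_dead) (auto simp: live_def lo_def)
  then show ?thesis using assms(1)[of "- 4" "2 * (- 3 - y)"] by (simp add: load_odd weight_def)
qed

text \<open>In \<open>load_zero_line\<close> the term \<open>(0, 2 - 4y)\<close> alone can use up the whole weight 1. For \<open>y\<close> between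
  11/30 and 23/60 the states with \<open>k = 3\<close> and \<open>k = -3\<close> are alive as well, but then \<open>2 - 4y\<close> is at least
  7/15. The weight 3/4 near the ends of the range of \<open>f\<close> is therefore carried along in the
  induction: a high level leads to a low level only, and for a low level \<open>(0, 2 - 4y)\<close> is dead
  while \<open>(0, -4y)\<close> enters with the coefficient one half.\<close>

lemma load_bound:
  "(\<forall>k y. load m k y \<le> weight k) \<and>
   (\<forall>y. y \<le> 2 / 15 \<or> 7 / 15 \<le> y \<longrightarrow> load m 0 y \<le> 3 / 4)"
proof (induction m rule: less_induct)
  case (less m)
  show ?case
  proof (cases "m < 5")
    case True
    have small: "load m k y \<le> 1 / 2" for k y
    proof -
      have "real (branches m k y) \<le> 2 ^ m" 
        using branches_le_power[of m k y] by (metis of_nat_le_iff of_nat_numeral of_nat_power)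
      also have "\<dots> \<le> 2 ^ 4" using True by (intro power_increasing) auto
      also have "\<dots> \<le> 16 * 2 ^ ((if even k then m else Suc m) div 2)" by simp
      finally show ?thesis by (simp add: load_def field_simps)
    qed
    have "load m k y \<le> weight k" for k y
      using small[of k y] by (simp add: weight_def)
    moreover have "load m 0 y \<le> 3 / 4" for y using small[of 0 y] by simp
    ultimately show ?thesis by blast
  next
    case False
    then have "m = Suc (Suc (Suc (Suc (Suc (m - 5)))))" by simp
    then obtain n where m: "m = Suc (Suc (Suc (Suc (Suc n))))" by blast
    have IH: "load j k y \<le> weight k" and special: "y \<le> 2 / 15 \<or> 7 / 15 \<le> y \<Longrightarrow> load j 0 y \<le> 3 / 4"
      if "j < m" for j k y using less that by auto
    define P where "P y = load (Suc (Suc (Suc n))) 0 y" for y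
    define Q where "Q y = load (Suc (Suc n)) 3 y" for y
    define R where "R y = load (Suc (Suc n)) (- 3) y" for y
    have rec: "2 * load m 0 y = 2 * P (2 - 4 * y) + P (- 4 * y) + Q (8 * y) + R (- 8 * y)" for y
      unfolding m P_def Q_def R_def by (subst load_zero_line) simp
    have P: "P y \<le> 1" and P': "y \<le> 2 / 15 \<or> 7 / 15 \<le> y \<Longrightarrow> P y \<le> 3 / 4"
      and Q: "Q y \<le> 1 / 2" and R: "R y \<le> 1 / 2" for y
      using IH[of "Suc (Suc (Suc n))" 0 y] special[of "Suc (Suc (Suc n))" y]
        IH[of "Suc (Suc n)" 3 y] IH[of "Suc (Suc n)" "- 3" y]
      by (auto simp: P_def Q_def R_def m weight_def)
    have P0: "\<not> live 0 y \<Longrightarrow> P y = 0" and Q0: "\<not> live 3 y \<Longrightarrow> Q y = 0"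
      and R0: "\<not> live (- 3) y \<Longrightarrow> R y = 0" for y
      by (simp_all add: P_def Q_def R_def load_dead)
    have P_zero: "y < - 2 / 15 \<or> 8 / 15 < y \<Longrightarrow> P y = 0"
      and Q_zero: "y \<le> 0 \<or> 3 \<le> y \<Longrightarrow> Q y = 0"
      and R_zero: "y < - 46 / 15 \<Longrightarrow> R y = 0" for y
      by (auto intro!: P0 Q0 R0 simp: live_def lo_def hi_def)
    have Q_low: "y < 2 \<Longrightarrow> Q y \<le> 1 / 4" and Q_top: "44 / 15 \<le> y \<Longrightarrow> Q y \<le> 1 / 4"
      and R_low: "y \<le> - 44 / 15 \<Longrightarrow> R y \<le> 1 / 4" for y
      using load_three_le[of "Suc n" y] load_three_top[of n y]
        load_minus_three_bottom[of "Suc n" y] IH by (auto simp: Q_def R_def m)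
    have zero: "load m 0 y \<le> 1" for y
    proof -
      consider "y < 11 / 30" | "23 / 60 < y" | "11 / 30 \<le> y" "y \<le> 23 / 60" by linarith
      then show ?thesis
      proof cases
        case 1
        then have "P (2 - 4 * y) = 0" by (intro P_zero) simp
        then show ?thesis
          using rec[of y] P[of "- 4 * y"] Q[of "8 * y"] R[of "- 8 * y"] by linarith
      next
        case 2
        then have "P (- 4 * y) = 0" "Q (8 * y) = 0" "R (- 8 * y) = 0"
          by (intro P_zero Q_zero R_zero; simp)+
        then show ?thesis using rec[of y] P[of "2 - 4 * y"] by linarith
      next
        case 3
        then have "P (- 4 * y) = 0" "P (2 - 4 * y) \<le> 3 / 4" "Q (8 * y) \<le> 1 / 4" "R (- 8 * y) \<le> 1 / 4"
          by (intro P_zero P' Q_top R_low; simp)+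
        then show ?thesis using rec[of y] by linarith
      qed
    qed
    have zero': "load m 0 y \<le> 3 / 4" if y: "y \<le> 2 / 15 \<or> 7 / 15 \<le> y" for y
    proof -
      consider "y \<le> 0" | "0 < y" "y \<le> 1 / 30" | "1 / 30 < y" "y \<le> 2 / 15" | "7 / 15 \<le> y"
        using y by linarith
      then show ?thesis
      proof cases
        case 1
        then have "P (2 - 4 * y) = 0" "Q (8 * y) = 0" by (intro P_zero Q_zero; simp)+
        then show ?thesis using rec[of y] P[of "- 4 * y"] R[of "- 8 * y"] by linarith
      next
        case 2
        then have "P (2 - 4 * y) = 0" "P (- 4 * y) \<le> 3 / 4" "Q (8 * y) \<le> 1 / 4"
          by (intro P_zero P' Q_low; simp)+
        then show ?thesis using rec[of y] R[of "- 8 * y"] by linarith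
      next
        case 3
        then have "P (2 - 4 * y) = 0" "P (- 4 * y) = 0" by (intro P_zero; simp)+
        then show ?thesis using rec[of y] Q[of "8 * y"] R[of "- 8 * y"] by linarith
      next
        case 4
        then have "P (2 - 4 * y) \<le> 3 / 4" "P (- 4 * y) = 0" "Q (8 * y) = 0" "R (- 8 * y) = 0"
          by (intro P' P_zero Q_zero R_zero; simp)+
        then show ?thesis using rec[of y] by linarith
      qed
    qed
    have "load m k y \<le> weight k" for k y
    proof (cases "k = 0")
      case True
      then show ?thesis using zero by (simp add: weight_def)
    next
      case False
      then show ?thesis unfolding m by (intro load_step_nonzero IH) (auto simp: m)
    qed
    then show ?thesis using zero' by blast
  qed
qed

lemma branches_zero_le: "real (branches (2 * m) 0 y) \<le> 32 * 2 ^ m"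
proof -
  have "load (2 * m) 0 y \<le> 1" using conjunct1[OF load_bound, rule_format, of "2 * m" 0 y] by (simp add: weight_def)
  then show ?thesis by (simp add: load_def field_simps)
qed

section \<open>The upper bound\<close>

lemma countable_dyadic: "countable ({0..1} - nondyadic)"
proof -
  have "{0..1} - nondyadic \<subseteq> (\<Union>n::nat. \<Union>i::int. {of_int i / 2 ^ n})"
  proof
    fix u :: real assume u: "u \<in> {0..1} - nondyadic"
    have "\<exists>n. 2 ^ n * u \<in> \<int>"
    proof (cases "u = 0 \<or> u = 1")
      case True
      then show ?thesis by auto
    next
      case False
      then show ?thesis using u by (auto simp: nondyadic_def)
    qed
    then obtain n i where "2 ^ n * u = of_int i" by (auto elim: Ints_cases)
    then have "u = of_int i / 2 ^ n" by (simp add: field_simps)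
    then show "u \<in> (\<Union>n::nat. \<Union>i::int. {of_int i / 2 ^ n})" by blast
  qed
  then show ?thesis by (rule countable_subset) auto
qed

text \<open>A countable set costs nothing for positive exponents, because its points have diameter 0; it
  fills the places of the covering sequence after the finitely many intervals.\<close>

lemma hausdorff_premeasure_le_covers:
  fixes A B :: "real set"
  assumes "0 < s" "0 \<le> r" "r \<le> \<delta>" "countable B"
    and cover: "A - B \<subseteq> (\<Union>c \<in> set cs. {c .. c + r})"
  shows "hausdorff_premeasure s \<delta> A \<le> ennreal (real (length cs) * r powr s)"
proof -
  obtain d where d: "B \<subseteq> range (d :: nat \<Rightarrow> real)"
  proof (cases "B = {}")
    case False
    then show ?thesis using that[of "from_nat_into B"] range_from_nat_into[OF False assms(4)] by simp
  qed (use that in blast)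
  define U where "U i = (if i < length cs then {cs ! i .. cs ! i + r} else {d (i - length cs)})" for i
  have U: "diam_power s (U i) = (if i < length cs then ennreal (r powr s) else 0)" for i
    using assms by (auto simp: U_def diam_power_def)
  have "A \<subseteq> (\<Union>i. U i)"
  proof
    fix x assume "x \<in> A"
    show "x \<in> (\<Union>i. U i)"
    proof (cases "x \<in> B")
      case True
      then obtain j where "x = d j" using d by blast
      then have "x \<in> U (length cs + j)" by (simp add: U_def)
      then show ?thesis by blast
    next
      case False
      then obtain c where "c \<in> set cs" "x \<in> {c .. c + r}" using cover \<open>x \<in> A\<close> by blast
      then obtain i where "i < length cs" "x \<in> {cs ! i .. cs ! i + r}"
        by (auto simp: in_set_conv_nth)
      then have "x \<in> U i" by (simp add: U_def)
      then show ?thesis by blast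
    qed
  qed
  moreover have "bounded (U i) \<and> diameter (U i) \<le> \<delta>" for i
    using assms by (auto simp: U_def)
  ultimately have "hausdorff_premeasure s \<delta> A \<le> (\<Sum>i. diam_power s (U i))"
    unfolding hausdorff_premeasure_def by (intro INF_lower) auto
  also have "\<dots> = (\<Sum>i<length cs. diam_power s (U i))"
    by (rule suminf_finite) (auto simp: U)
  also have "\<dots> = (\<Sum>i<length cs. ennreal (r powr s))" by (rule sum.cong) (auto simp: U)
  also have "\<dots> = ennreal (real (length cs) * r powr s)"
    by (simp add: ennreal_of_nat_eq_real_of_nat ennreal_mult)
  finally show ?thesis .
qed

lemma hausdorff_measure_level_set_zero:
  assumes "1 / 2 < s"
  shows "hausdorff_measure s (level_set gray_takagi y) = 0"
proof -
  \<comment> \<open>The cost of covering by at most \<open>32 \<cdot> 2\<^sup>m\<close> intervals of length \<open>4\<^sup>-\<^sup>m\<close> decays like \<open>q\<^sup>m\<close>.\<close>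
  define q where "q = 2 * (1 / 4) powr s"
  have q: "0 < q" "q < 1"
  proof -
    have "(1 / 4) powr s < (1 / 4 :: real) powr (1 / 2)"
      using assms by (intro powr_less_mono') auto
    also have "\<dots> = 1 / 2" by (simp add: powr_half_sqrt real_sqrt_divide)
    finally show "q < 1" by (simp add: q_def)
  qed (simp add: q_def)
  have bound: "hausdorff_premeasure s \<delta> (level_set gray_takagi y) \<le> ennreal (32 * q ^ m)"
    if "(1 / 4) ^ m \<le> \<delta>" for m \<delta>
  proof -
    obtain cs where cs: "length cs = branches (2 * m) 0 y"
      "{u \<in> nondyadic. tilted 0 u = y} \<subseteq> (\<Union>c \<in> set cs. {c .. c + 1 / 2 ^ (2 * m)})"
      using branches_cover by blast
    have r: "1 / 2 ^ (2 * m) = ((1 / 4) ^ m :: real)" by (simp add: power_mult power_one_over)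
    have "hausdorff_premeasure s \<delta> (level_set gray_takagi y)
        \<le> ennreal (real (length cs) * ((1 / 4) ^ m) powr s)"
      using cs(2) assms that countable_dyadic unfolding r
      by (intro hausdorff_premeasure_le_covers[of _ _ _ "{0..1} - nondyadic"])
         (auto simp: level_set_def tilted_def)
    also have "real (length cs) * ((1 / 4) ^ m) powr s \<le> 32 * 2 ^ m * ((1 / 4) ^ m) powr s"
      using branches_zero_le[of m y] cs(1) by (intro mult_right_mono) auto
    also have "\<dots> = 32 * q ^ m"
    proof -
      have "((1 / 4) ^ m) powr s = ((1 / 4 :: real) powr s) ^ m"
        by (simp add: powr_powr mult.commute flip: powr_realpow)
      then show ?thesis by (simp add: q_def power_mult_distrib)
    qed
    finally show ?thesis by (simp add: ennreal_leI)
  qed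
  have "hausdorff_premeasure s \<delta> (level_set gray_takagi y) = 0" if "0 < \<delta>" for \<delta>
  proof -
    have "(\<lambda>m. ennreal (32 * q ^ m)) \<longlonglongrightarrow> ennreal (32 * 0)"
      using q by (intro tendsto_ennrealI tendsto_mult_left LIMSEQ_power_zero) auto
    moreover have "eventually (\<lambda>m. (1 / 4) ^ m < \<delta>) sequentially"
      by (rule order_tendstoD(2)[OF LIMSEQ_power_zero that]) auto
    then have "eventually (\<lambda>m. hausdorff_premeasure s \<delta> (level_set gray_takagi y)
        \<le> ennreal (32 * q ^ m)) sequentially"
      by eventually_elim (auto intro: bound)
    ultimately have "hausdorff_premeasure s \<delta> (level_set gray_takagi y) \<le> ennreal (32 * 0)"
      by (rule tendsto_lowerbound) simp
    then show ?thesis by simp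
  qed
  then show ?thesis by (auto simp: hausdorff_measure_def)
qed

lemma hausdorff_dim_level_set_le: "hausdorff_dim (level_set gray_takagi y) \<le> ennreal (1 / 2)"
proof (rule ennreal_le_epsilon)
  fix e :: real assume "0 < e"
  then have "hausdorff_dim (level_set gray_takagi y) \<le> ennreal (1 / 2 + e)"
    unfolding hausdorff_dim_def by (intro INF_lower) (auto intro: hausdorff_measure_level_set_zero)
  also have "\<dots> = ennreal (1 / 2) + ennreal e" using \<open>0 < e\<close> by (intro ennreal_plus) auto
  finally show "hausdorff_dim (level_set gray_takagi y) \<le> ennreal (1 / 2) + ennreal e" .
qed

section \<open>A level set of dimension one half\<close>

definition doubling :: "real \<Rightarrow> real" where
  "doubling t = (if t < 1 / 2 then 2 * t else 2 * t - 1)"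

definition digit_offset :: "real \<Rightarrow> real" where
  "digit_offset t = (if t < 1 / 2 then 1 / 2 else 1)"

text \<open>The point of the Cantor set of \<open>v \<mapsto> 1/2 - v/4\<close> and \<open>v \<mapsto> 1 - v/4\<close> whose sequence of maps is
  given by the binary digits of \<open>t\<close>; the defining property is \<open>cantor_point_rec\<close>.\<close>

definition cantor_point :: "real \<Rightarrow> real" where
  "cantor_point t = (\<Sum>n. (- 1 / 4) ^ n * digit_offset ((doubling ^^ n) t))"

lemma norm_cantor_term: "norm ((- 1 / 4) ^ n * digit_offset ((doubling ^^ n) t)) \<le> (1 / 4) ^ n"
  by (simp add: digit_offset_def power_abs abs_mult)

lemma summable_cantor: "summable (\<lambda>n. (- 1 / 4) ^ n * digit_offset ((doubling ^^ n) t))"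
proof (rule summable_comparison_test'[of "\<lambda>n. (1/4) ^ n" 0])
  show "summable (\<lambda>n. (1/4 :: real) ^ n)" by simp
qed (rule norm_cantor_term)

lemma cantor_point_rec: "cantor_point t = digit_offset t - cantor_point (doubling t) / 4"
proof -
  have "(\<lambda>n. (- 1 / 4) ^ Suc n * digit_offset ((doubling ^^ Suc n) t))
      = (\<lambda>n. (- 1 / 4) * ((- 1 / 4) ^ n * digit_offset ((doubling ^^ n) (doubling t))))"
    by (simp add: funpow_swap1)
  then have "(\<Sum>n. (- 1 / 4) ^ Suc n * digit_offset ((doubling ^^ Suc n) t)) = - (1 / 4) * cantor_point (doubling t)"
    by (simp only: suminf_mult[OF summable_cantor] cantor_point_def)
  then show ?thesis
    using suminf_split_head[OF summable_cantor[of t]] by (simp add: cantor_point_def)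
qed

lemma abs_cantor_point_le: "\<bar>cantor_point t\<bar> \<le> 2"
proof -
  have "norm (\<Sum>n. (- 1 / 4) ^ n * digit_offset ((doubling ^^ n) t)) \<le> (\<Sum>n. (1/4) ^ n)"
    by (rule norm_suminf_le[OF norm_cantor_term]) auto
  then show ?thesis by (simp add: cantor_point_def suminf_geometric)
qed

lemma cantor_point_range: "0 \<le> cantor_point t" "cantor_point t \<le> 1"
proof -
  have *: "0 \<le> cantor_point t + 2 * (1/2) ^ n \<and> cantor_point t \<le> 1 + 2 * (1/2) ^ n" for n t
  proof (induction n arbitrary: t)
    case 0
    then show ?case using abs_cantor_point_le[of t] by (auto simp: abs_le_iff)
  next
    case (Suc n)
    have "0 \<le> (1/2 :: real) ^ n" by simp
    moreover have "digit_offset t = 1 / 2 \<or> digit_offset t = 1" by (simp add: digit_offset_def)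
    ultimately show ?case using Suc[of "doubling t"] cantor_point_rec[of t]
      unfolding power_Suc by linarith
  qed
  show "0 \<le> cantor_point t" by (rule le_by_halving[OF conjunct1[OF *]])
  show "cantor_point t \<le> 1" by (rule le_by_halving[OF conjunct2[OF *]])
qed

text \<open>The two loops \<open>1 \<rightarrow> 2 \<rightarrow> 1\<close> and \<open>1 \<rightarrow> 0 \<rightarrow> 1\<close> in the tree of states act in the same way on levels,
  and this common action has the fixed point 4/5.\<close>

lemma tilted_one_similarity:
  assumes "0 \<le> v" "v \<le> 1"
  shows "tilted 1 (1 / 2 - v / 4) = 1 - tilted 1 v / 4" "tilted 1 (1 - v / 4) = 1 - tilted 1 v / 4"
proof -
  show "tilted 1 (1 / 2 - v / 4) = 1 - tilted 1 v / 4"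
    using assms tilted_left[of "1 - v / 2" 1] tilted_right[of v 2] by (simp add: diff_divide_distrib)
  show "tilted 1 (1 - v / 4) = 1 - tilted 1 v / 4"
    using assms tilted_right[of "v / 2" 1] tilted_left[of v 0] by simp
qed

lemma tilted_cantor_point: "tilted 1 (cantor_point t) = 4 / 5"
proof -
  have rec: "tilted 1 (cantor_point t) = 1 - tilted 1 (cantor_point (doubling t)) / 4" for t
    using tilted_one_similarity[OF cantor_point_range, of "doubling t"]
    by (subst cantor_point_rec) (simp add: digit_offset_def)
  have "\<bar>tilted 1 (cantor_point t) - 4 / 5\<bar> \<le> 0 + 4 * (1/2) ^ n" for n t
  proof (induction n arbitrary: t)
    case 0
    then show ?case using abs_gray_takagi_le[of "cantor_point t"] cantor_point_range[of t] by (simp add: tilted_def)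
  next
    case (Suc n)
    show ?case using rec[of t] Suc.IH[of "doubling t"] unfolding abs_le_iff power_Suc by linarith
  qed
  then have "\<bar>tilted 1 (cantor_point t) - 4 / 5\<bar> \<le> 0" by (rule le_by_halving)
  then show ?thesis by simp
qed

text \<open>Doubling removes a common first digit; it multiplies the distance of the parameters by 2 and
  that of the points by 4, so the ratio of the squared one to the other is unchanged. Once the first digits
  differ, the points lie in different first-level pieces, at distance at least 1/4.\<close>

lemma cantor_point_separation:
  assumes "t \<in> {0..<1}" "t' \<in> {0..<1}"
  shows "(t - t')\<^sup>2 \<le> 4 * \<bar>cantor_point t - cantor_point t'\<bar>"
proof (cases "t = t'")
  case False
  have main: "(t - t')\<^sup>2 \<le> 4 * \<bar>cantor_point t - cantor_point t'\<bar>"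
    if "(1/2) ^ n \<le> \<bar>t - t'\<bar>" "t \<in> {0..<1}" "t' \<in> {0..<1}" for n and t t' :: real
    using that
  proof (induction n arbitrary: t t')
    case 0
    then show ?case by auto
  next
    case (Suc n)
    show ?case
    proof (cases "t < 1 / 2 \<longleftrightarrow> t' < 1 / 2")
      case True
      have D: "doubling t - doubling t' = 2 * (t - t')" "doubling t \<in> {0..<1}" "doubling t' \<in> {0..<1}"
        using True Suc.prems by (auto simp: doubling_def)
      have "cantor_point t - cantor_point t' = - ((cantor_point (doubling t) - cantor_point (doubling t')) / 4)"
        using True cantor_point_rec[of t] cantor_point_rec[of t']
        by (simp add: digit_offset_def diff_divide_distrib)
      then have C: "4 * \<bar>cantor_point t - cantor_point t'\<bar> = \<bar>cantor_point (doubling t) - cantor_point (doubling t')\<bar>"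
        by simp
      have "(doubling t - doubling t')\<^sup>2 \<le> 4 * \<bar>cantor_point (doubling t) - cantor_point (doubling t')\<bar>"
      proof (rule Suc.IH)
        show "(1 / 2) ^ n \<le> \<bar>doubling t - doubling t'\<bar>"
          using Suc.prems(1) unfolding D(1) abs_mult by simp
      qed (rule D)+
      moreover have "(doubling t - doubling t')\<^sup>2 = 4 * (t - t')\<^sup>2"
        unfolding D(1) power_mult_distrib by simp
      ultimately have "4 * (t - t')\<^sup>2 \<le> 4 * (4 * \<bar>cantor_point t - cantor_point t'\<bar>)"
        by (simp only: C)
      then show ?thesis by simp
    next
      case False
      have "1 / 4 \<le> \<bar>cantor_point t - cantor_point t'\<bar>"
        using False cantor_point_rec[of t] cantor_point_rec[of t'] 
          cantor_point_range[of "doubling t"] cantor_point_range[of "doubling t'"]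
        by (auto simp: digit_offset_def split: if_splits)
      moreover have "\<bar>t - t'\<bar> \<le> 1" using Suc.prems by auto
      then have "(t - t')\<^sup>2 \<le> 1" by (simp add: abs_square_le_1)
      ultimately show ?thesis by simp
    qed
  qed
  obtain n where "(1/2) ^ n < \<bar>t - t'\<bar>" using real_arch_pow_inv[of "\<bar>t - t'\<bar>" "1/2"] False by auto
  then show ?thesis using main[of n t t'] assms by simp
qed simp

lemma cantor_point_level: "cantor_point t / 2 \<in> level_set gray_takagi (2 / 5)"
  using gray_takagi_left[OF cantor_point_range, of t] cantor_point_range[of t] tilted_cantor_point[of t]
  by (simp add: level_set_def tilted_def)

lemma diam_power_antimono:
  assumes "0 \<le> s" "s \<le> s'" "bounded U" "diameter U \<le> 1"
  shows "diam_power s' U \<le> diam_power s U"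
proof (cases "s = 0 \<and> 0 < s'")
  case True
  have "diameter U powr s' \<le> 1 powr s'"
    using assms True diameter_ge_0[of U] by (intro powr_mono2) auto
  then show ?thesis using True by (auto simp: diam_power_def ennreal_le_1)
next
  case False
  then show ?thesis using assms diameter_ge_0[of U]
    by (auto simp: diam_power_def intro!: ennreal_leI powr_mono')
qed

text \<open>Mass distribution by pulling back: the parameters of the points in a piece of a cover lie in
  an interval whose length is controlled by the square root of the diameter of the piece, and these intervals
  cover the unit interval.\<close>

lemma hausdorff_premeasure_half_ge:
  fixes A :: "real set" and g :: "real \<Rightarrow> real"
  assumes g: "\<And>t. t \<in> {0..<1} \<Longrightarrow> g t \<in> A" and "0 < c"
    and sep: "\<And>t t'. t \<in> {0..<1} \<Longrightarrow> t' \<in> {0..<1} \<Longrightarrow> \<bar>t - t'\<bar> \<le> c * \<bar>g t - g t'\<bar> powr (1 / 2)"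
  shows "ennreal (1 / (2 * c)) \<le> hausdorff_premeasure (1 / 2) \<delta> A"
  unfolding hausdorff_premeasure_def
proof (rule INF_greatest)
  fix U :: "nat \<Rightarrow> real set"
  assume "U \<in> {U. A \<subseteq> (\<Union>i. U i) \<and> (\<forall>i. bounded (U i) \<and> diameter (U i) \<le> \<delta>)}"
  then have cover: "A \<subseteq> (\<Union>i. U i)" and bdd: "\<And>i. bounded (U i)" by auto
  define V where "V i = {t \<in> {0..<1}. g t \<in> U i}" for i
  define w where "w i = c * diameter (U i) powr (1 / 2)" for i
  define J where "J i = (if V i = {} then {} else {(SOME t. t \<in> V i) - w i .. (SOME t. t \<in> V i) + w i})" for i
  have w: "0 \<le> w i" for i using \<open>0 < c\<close> by (simp add: w_def)
  have "V i \<subseteq> J i" for i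
  proof
    fix t assume t: "t \<in> V i"
    define t0 where "t0 = (SOME t. t \<in> V i)"
    have t0: "t0 \<in> V i" unfolding t0_def by (rule someI[of "\<lambda>t. t \<in> V i", OF t])
    have "\<bar>t - t0\<bar> \<le> c * \<bar>g t - g t0\<bar> powr (1 / 2)" using t t0 by (intro sep) (auto simp: V_def)
    also have "\<dots> \<le> w i" unfolding w_def
      using t t0 \<open>0 < c\<close> diameter_bounded_bound[OF bdd[of i], of "g t" "g t0"]
      by (intro mult_left_mono powr_mono2) (auto simp: V_def dist_real_def)
    finally show "t \<in> J i" using t by (auto simp: J_def t0_def[symmetric])
  qed
  then have "(\<Union>i. V i) \<subseteq> (\<Union>i. J i)" by (intro UN_mono subset_refl)
  moreover have "{0..<1} \<subseteq> (\<Union>i. V i)"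
  proof
    fix t :: real assume t: "t \<in> {0..<1}"
    have "g t \<in> (\<Union>i. U i)" by (rule subsetD[OF cover g[OF t]])
    then obtain i where "g t \<in> U i" by (rule UN_E)
    then show "t \<in> (\<Union>i. V i)" using t by (intro UN_I[of i]) (simp_all add: V_def)
  qed
  ultimately have sub: "{0..<1} \<subseteq> (\<Union>i. J i)" by (rule order_trans[rotated])
  have J: "emeasure lborel (J i) \<le> ennreal (2 * c) * diam_power (1 / 2) (U i)" for i
  proof (cases "V i = {}")
    case False
    then have "U i \<noteq> {}" by (auto simp: V_def)
    then show ?thesis using False w[of i] \<open>0 < c\<close>
      by (simp add: J_def diam_power_def w_def mult.assoc flip: ennreal_mult)
  qed (simp add: J_def)
  have "1 = emeasure lborel {0..<1::real}" by simp
  also have "\<dots> \<le> emeasure lborel (\<Union>i. J i)" by (rule emeasure_mono[OF sub]) (auto simp: J_def)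
  also have "\<dots> \<le> (\<Sum>i. emeasure lborel (J i))"
    by (rule emeasure_subadditive_countably) (auto simp: J_def)
  also have "\<dots> \<le> (\<Sum>i. ennreal (2 * c) * diam_power (1 / 2) (U i))" by (intro suminf_le J) auto
  also have "\<dots> = ennreal (2 * c) * (\<Sum>i. diam_power (1 / 2) (U i))" by (rule ennreal_suminf_cmult)
  finally have "ennreal (1 / (2 * c)) * 1 \<le> ennreal (1 / (2 * c)) * (ennreal (2 * c) * (\<Sum>i. diam_power (1 / 2) (U i)))"
    by (rule mult_left_mono) simp
  also have "\<dots> = (\<Sum>i. diam_power (1 / 2) (U i))"
    using \<open>0 < c\<close> by (simp add: mult.assoc[symmetric] flip: ennreal_mult)
  finally show "ennreal (1 / (2 * c)) \<le> (\<Sum>i. diam_power (1 / 2) (U i))" by simp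
qed

lemma hausdorff_premeasure_antimono:
  assumes "0 \<le> s" "s \<le> s'"
  shows "hausdorff_premeasure s' 1 A \<le> hausdorff_premeasure s 1 A"
  unfolding hausdorff_premeasure_def
  using assms by (intro INF_mono) (auto intro!: bexI suminf_le diam_power_antimono)

lemma hausdorff_dim_level_set_ge: "ennreal (1 / 2) \<le> hausdorff_dim (level_set gray_takagi (2 / 5))"
  unfolding hausdorff_dim_def
proof (rule INF_greatest)
  let ?A = "level_set gray_takagi (2 / 5)"
  have sep: "\<bar>t - t'\<bar> \<le> 3 * \<bar>cantor_point t / 2 - cantor_point t' / 2\<bar> powr (1 / 2)"
    if "t \<in> {0..<1}" "t' \<in> {0..<1}" for t t'
  proof -
    have "(t - t')\<^sup>2 \<le> 9 * \<bar>cantor_point t / 2 - cantor_point t' / 2\<bar>"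
    proof -
      have "\<bar>cantor_point t / 2 - cantor_point t' / 2\<bar> = \<bar>cantor_point t - cantor_point t'\<bar> / 2"
        by (simp flip: diff_divide_distrib)
      then have "4 * \<bar>cantor_point t - cantor_point t'\<bar> \<le> 9 * \<bar>cantor_point t / 2 - cantor_point t' / 2\<bar>"
        by (simp only:)
      with cantor_point_separation[OF that] show ?thesis by (rule order_trans)
    qed
    then have "sqrt ((t - t')\<^sup>2) \<le> sqrt (9 * \<bar>cantor_point t / 2 - cantor_point t' / 2\<bar>)"
      by (rule real_sqrt_le_mono)
    then show ?thesis by (simp add: real_sqrt_mult powr_half_sqrt)
  qed
  fix s assume "s \<in> {s. 0 \<le> s \<and> hausdorff_measure s ?A = 0}"
  then have s: "0 \<le> s" "hausdorff_measure s ?A = 0" by auto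
  have "1 / 2 \<le> s"
  proof (rule ccontr)
    assume "\<not> 1 / 2 \<le> s"
    have "ennreal (1 / (2 * 3)) \<le> hausdorff_premeasure (1 / 2) 1 ?A"
      by (rule hausdorff_premeasure_half_ge[OF cantor_point_level _ sep]) auto
    also have "\<dots> \<le> hausdorff_premeasure s 1 ?A"
      using s(1) \<open>\<not> 1 / 2 \<le> s\<close> by (intro hausdorff_premeasure_antimono) auto
    also have "\<dots> \<le> hausdorff_measure s ?A"
      unfolding hausdorff_measure_def by (rule SUP_upper) auto
    finally show False using s(2) by (simp add: ennreal_eq_0_iff)
  qed
  then show "ennreal (1 / 2) \<le> ennreal s" by (rule ennreal_leI)
qed

theorem theorem1p2:
  shows "(\<exists>y::real. hausdorff_dim (level_set gray_takagi y) = ennreal (1/2))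
       \<and> (\<forall>y::real. hausdorff_dim (level_set gray_takagi y) \<le> ennreal (1/2))"
  using hausdorff_dim_level_set_le hausdorff_dim_level_set_ge by (blast intro: antisym)

end
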